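(* (Completeness of $\mathsf{LNIF}$.) For every first-order formula $A$, if $\vdash_{\mathsf{IF}} A$, then the linear nested sequent $\ \vdash A'$ (a single component with empty antecedent) is derivable in $\mathsf{LNIF}$, where $A'$ is obtained from $A$ by replacing its free variables by distinct parameters.
   Context: $\mathsf{IF}$ (intuitionistic fuzzy logic) is the smallest set of first-order formulae (over $\bot,\land,\lor,\supset,\forall,\exists$) containing all instances of: $A\supset(B\supset A)$; $(A\supset(B\supset C))\supset((A\supset B)\supset(A\supset C))$; $A\supset(B\supset(A\land B))$; $(A\land B)\supset A$; $(A\land B)\supset B$; $A\supset(A\lor B)$; $B\supset(A\lor B)$; $(A\supset C)\supset((B\supset C)\supset((A\lor B)\supset C))$; $\bot\supset A$; $(A\supset B)\lor(B\supset A)$; $\forall xA\supset A[y/x]$ and $A[y/x]\supset\exists xA$ ($y$ free for $x$); $\forall x(B\supset A(x))\supset(B\supset\forall xA(x))$ and $\forall x(A(x)\supset B)\supset(\exists xA(x)\supset B)$ and $\forall x(A(x)\lor B)\supset(\forall xA(x)\lor B)$ (with $x$ not free in $B$); and closed under modus ponens (from $A$ and $A\supset B$ infer $B$) and generalization (from $A$ infer $\forall xA$). $\vdash_{\mathsf{IF}}A$ means $A\in\mathsf{IF}$. Formulae in sequents: bound variables $x,y,\dots$ are distinct from parameters $a,b,\dots$, which occupy all free positions; $A[a/x]$ replaces free occurrences of $x$ by $a$; $p(\vec a)$ is an atomic formula with parameters $\vec a$. A linear nested sequent is $\Gamma_1\vdash\Delta_1 /\!/ \cdots /\!/ \Gamma_n\vdash\Delta_n$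 ($n\ge1$), each $\Gamma_i,\Delta_i$ a finite, possibly empty, multiset of formulae (a component). In rule schemas, $\mathcal{G},\mathcal{H},\mathcal{F}$ denote possibly empty sequences of components. $\mathsf{LNIF}$ has the rules (from premise(s) infer conclusion): Initial: $(id_1)$ $\mathcal{G}/\!/\Gamma,p(\vec a)\vdash p(\vec a),\Delta/\!/\mathcal{H}$; $(id_2)$ $\mathcal{G}/\!/\Gamma_1,p(\vec a)\vdash\Delta_1/\!/\mathcal{H}/\!/\Gamma_2\vdash p(\vec a),\Delta_2/\!/\mathcal{F}$; $(\bot_l)$ $\mathcal{G}/\!/\Gamma,\bot\vdash\Delta/\!/\mathcal{H}$. $(\land_l)$: from $\mathcal{G}/\!/\Gamma,A,B\vdash\Delta/\!/\mathcal{H}$ infer $\mathcal{G}/\!/\Gamma,A\land B\vdash\Delta/\!/\mathcal{H}$. $(\lor_r)$: from $\mathcal{G}/\!/\Gamma\vdash\Delta,A,B/\!/\mathcal{H}$ infer $\mathcal{G}/\!/\Gamma\vdash\Delta,A\lor B/\!/\mathcal{H}$. $(\land_r)$: from $\mathcal{G}/\!/\Gamma\vdash\Delta,A/\!/\mathcal{H}$ and $\mathcal{G}/\!/\Gamma\vdash\Delta,B/\!/\mathcal{H}$ infer $\mathcal{G}/\!/\Gamma\vdash\Delta,A\land B/\!/\mathcal{H}$. $(\lor_l)$: from $\mathcal{G}/\!/\Gamma,A\vdash\Delta/\!/\mathcal{H}$ and $\mathcal{G}/\!/\Gamma,B\vdash\Delta/\!/\mathcal{H}$ infer $\mathcal{G}/\!/\Gamma,A\lor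 B\vdash\Delta/\!/\mathcal{H}$. $(\supset_{r1})$: from $\mathcal{G}/\!/\Gamma\vdash\Delta/\!/A\vdash B$ infer $\mathcal{G}/\!/\Gamma\vdash\Delta,A\supset B$. $(\supset_l)$: from $\mathcal{G}/\!/\Gamma,B\vdash\Delta/\!/\mathcal{H}$ and $\mathcal{G}/\!/\Gamma,A\supset B\vdash A,\Delta/\!/\mathcal{H}$ infer $\mathcal{G}/\!/\Gamma,A\supset B\vdash\Delta/\!/\mathcal{H}$. $(lift)$: from $\mathcal{G}/\!/\Gamma_1,A\vdash\Delta_1/\!/\Gamma_2,A\vdash\Delta_2/\!/\mathcal{H}$ infer $\mathcal{G}/\!/\Gamma_1,A\vdash\Delta_1/\!/\Gamma_2\vdash\Delta_2/\!/\mathcal{H}$. $(\forall_l)$: from $\mathcal{G}/\!/\Gamma,A[a/x],\forall xA\vdash\Delta/\!/\mathcal{H}$ infer $\mathcal{G}/\!/\Gamma,\forall xA\vdash\Delta/\!/\mathcal{H}$ ($a$ any parameter). $(\forall_{r1})$: from $\mathcal{G}/\!/\Gamma\vdash\Delta/\!/\ \vdash A[a/x]$ infer $\mathcal{G}/\!/\Gamma\vdash\Delta,\forall xA$. $(\exists_l)$: from $\mathcal{G}/\!/\Gamma,A[a/x]\vdash\Delta/\!/\mathcal{H}$ infer $\mathcal{G}/\!/\Gamma,\exists xA\vdash\Delta/\!/\mathcal{H}$. $(\exists_r)$: from $\mathcal{G}/\!/\Gamma\vdash A[a/x],\exists xA,\Delta/\!/\mathcal{H}$ infer $\mathcal{G}/\!/\Gamma\vdash\exists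 xA,\Delta/\!/\mathcal{H}$ ($a$ any parameter). $(\supset_{r2})$: from $\mathcal{G}/\!/\Gamma_1\vdash\Delta_1/\!/A\vdash B/\!/\Gamma_2\vdash\Delta_2/\!/\mathcal{H}$ and $\mathcal{G}/\!/\Gamma_1\vdash\Delta_1/\!/\Gamma_2\vdash\Delta_2,A\supset B/\!/\mathcal{H}$ infer $\mathcal{G}/\!/\Gamma_1\vdash\Delta_1,A\supset B/\!/\Gamma_2\vdash\Delta_2/\!/\mathcal{H}$. $(\forall_{r2})$: from $\mathcal{G}/\!/\Gamma_1\vdash\Delta_1/\!/\ \vdash A[a/x]/\!/\Gamma_2\vdash\Delta_2/\!/\mathcal{H}$ and $\mathcal{G}/\!/\Gamma_1\vdash\Delta_1/\!/\Gamma_2\vdash\Delta_2,\forall xA/\!/\mathcal{H}$ infer $\mathcal{G}/\!/\Gamma_1\vdash\Delta_1,\forall xA/\!/\Gamma_2\vdash\Delta_2/\!/\mathcal{H}$. In $(\forall_{r1}),(\exists_l),(\forall_{r2})$, $a$ is an eigenvariable (does not occur in the conclusion). *)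

theory Defs
  imports Main "HOL-Library.Multiset"
begin

text \<open>
  Variables are the bindable names; parameters are never bound. Following the source language there
  are no function symbols. A pair of a predicate name and an argument count acts as one predicate
  symbol of that arity.
\<close>

type_synonym var = nat
type_synonym par = nat

datatype tm = Var var | Par par

datatype 'p fm =
    Atom 'p "tm list"
  | Falsum  (\<open>\<^bold>\<bottom>\<close>)
  | Conj "'p fm" "'p fm"  (infixr \<open>\<^bold>\<and>\<close> 72)
  | Disj "'p fm" "'p fm"  (infixr \<open>\<^bold>\<or>\<close> 71)
  | Impl "'p fm" "'p fm"  (infixr \<open>\<^bold>\<longrightarrow>\<close> 70)
  | Forall var "'p fm"
  | Exists var "'p fm"

primrec fv_tm :: "tm \<Rightarrow> var set" where
  "fv_tm (Var x) = {x}"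
| "fv_tm (Par a) = {}"

primrec pars_tm :: "tm \<Rightarrow> par set" where
  "pars_tm (Var x) = {}"
| "pars_tm (Par a) = {a}"

primrec fv :: "'p fm \<Rightarrow> var set" where
  "fv (Atom p ts) = (\<Union>t\<in>set ts. fv_tm t)"
| "fv \<^bold>\<bottom> = {}"
| "fv (A \<^bold>\<and> B) = fv A \<union> fv B"
| "fv (A \<^bold>\<or> B) = fv A \<union> fv B"
| "fv (A \<^bold>\<longrightarrow> B) = fv A \<union> fv B"
| "fv (Forall x A) = fv A - {x}"
| "fv (Exists x A) = fv A - {x}"

primrec pars :: "'p fm \<Rightarrow> par set" where
  "pars (Atom p ts) = (\<Union>t\<in>set ts. pars_tm t)"
| "pars \<^bold>\<bottom> = {}"
| "pars (A \<^bold>\<and> B) = pars A \<union> pars B"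
| "pars (A \<^bold>\<or> B) = pars A \<union> pars B"
| "pars (A \<^bold>\<longrightarrow> B) = pars A \<union> pars B"
| "pars (Forall x A) = pars A"
| "pars (Exists x A) = pars A"

primrec inst_tm :: "(var \<Rightarrow> tm) \<Rightarrow> tm \<Rightarrow> tm" where
  "inst_tm \<sigma> (Var x) = \<sigma> x"
| "inst_tm \<sigma> (Par a) = Par a"

text \<open>
  Simultaneous replacement of free occurrences of variables. Bound variables are not renamed, so
  replacing by a variable can capture it (see \<open>free_for\<close>); replacing by a parameter cannot.
\<close>

primrec inst :: "(var \<Rightarrow> tm) \<Rightarrow> 'p fm \<Rightarrow> 'p fm" where
  "inst \<sigma> (Atom p ts) = Atom p (map (inst_tm \<sigma>) ts)"
| "inst \<sigma> \<^bold>\<bottom> = \<^bold>\<bottom>"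
| "inst \<sigma> (A \<^bold>\<and> B) = inst \<sigma> A \<^bold>\<and> inst \<sigma> B"
| "inst \<sigma> (A \<^bold>\<or> B) = inst \<sigma> A \<^bold>\<or> inst \<sigma> B"
| "inst \<sigma> (A \<^bold>\<longrightarrow> B) = inst \<sigma> A \<^bold>\<longrightarrow> inst \<sigma> B"
| "inst \<sigma> (Forall x A) = Forall x (inst (\<sigma>(x := Var x)) A)"
| "inst \<sigma> (Exists x A) = Exists x (inst (\<sigma>(x := Var x)) A)"

text \<open>\<open>subst x t A\<close> is $A[t/x]$.\<close>

abbreviation subst :: "var \<Rightarrow> tm \<Rightarrow> 'p fm \<Rightarrow> 'p fm" where
  "subst x t A \<equiv> inst (Var(x := t)) A"

text \<open>\<open>free_for y x A\<close>: no free occurrence of \<open>x\<close> in \<open>A\<close> is in the scope of a quantifier on \<open>y\<close>.\<close>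

primrec free_for :: "var \<Rightarrow> var \<Rightarrow> 'p fm \<Rightarrow> bool" where
  "free_for y x (Atom p ts) \<longleftrightarrow> True"
| "free_for y x \<^bold>\<bottom> \<longleftrightarrow> True"
| "free_for y x (A \<^bold>\<and> B) \<longleftrightarrow> free_for y x A \<and> free_for y x B"
| "free_for y x (A \<^bold>\<or> B) \<longleftrightarrow> free_for y x A \<and> free_for y x B"
| "free_for y x (A \<^bold>\<longrightarrow> B) \<longleftrightarrow> free_for y x A \<and> free_for y x B"
| "free_for y x (Forall z A) \<longleftrightarrow> x \<notin> fv (Forall z A) \<or> z \<noteq> y \<and> free_for y x A"
| "free_for y x (Exists z A) \<longleftrightarrow> x \<notin> fv (Exists z A) \<or> z \<noteq> y \<and> free_for y x A"


section \<open>The Hilbert system for intuitionistic fuzzy logic\<close>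

inductive_set IF_axioms :: "'p fm set" where
  K: "A \<^bold>\<longrightarrow> (B \<^bold>\<longrightarrow> A) \<in> IF_axioms"
| S: "(A \<^bold>\<longrightarrow> (B \<^bold>\<longrightarrow> C)) \<^bold>\<longrightarrow> ((A \<^bold>\<longrightarrow> B) \<^bold>\<longrightarrow> (A \<^bold>\<longrightarrow> C)) \<in> IF_axioms"
| conj_I: "A \<^bold>\<longrightarrow> (B \<^bold>\<longrightarrow> (A \<^bold>\<and> B)) \<in> IF_axioms"
| conj_E1: "(A \<^bold>\<and> B) \<^bold>\<longrightarrow> A \<in> IF_axioms"
| conj_E2: "(A \<^bold>\<and> B) \<^bold>\<longrightarrow> B \<in> IF_axioms"
| disj_I1: "A \<^bold>\<longrightarrow> (A \<^bold>\<or> B) \<in> IF_axioms"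
| disj_I2: "B \<^bold>\<longrightarrow> (A \<^bold>\<or> B) \<in> IF_axioms"
| disj_E: "(A \<^bold>\<longrightarrow> C) \<^bold>\<longrightarrow> ((B \<^bold>\<longrightarrow> C) \<^bold>\<longrightarrow> ((A \<^bold>\<or> B) \<^bold>\<longrightarrow> C)) \<in> IF_axioms"
| falsum_E: "\<^bold>\<bottom> \<^bold>\<longrightarrow> A \<in> IF_axioms"
| linearity: "(A \<^bold>\<longrightarrow> B) \<^bold>\<or> (B \<^bold>\<longrightarrow> A) \<in> IF_axioms"
| forall_E: "free_for y x A \<Longrightarrow> Forall x A \<^bold>\<longrightarrow> subst x (Var y) A \<in> IF_axioms"
| exists_I: "free_for y x A \<Longrightarrow> subst x (Var y) A \<^bold>\<longrightarrow> Exists x A \<in> IF_axioms"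
| forall_shift_impl:
    "x \<notin> fv B \<Longrightarrow> Forall x (B \<^bold>\<longrightarrow> A) \<^bold>\<longrightarrow> (B \<^bold>\<longrightarrow> Forall x A) \<in> IF_axioms"
| exists_shift_impl:
    "x \<notin> fv B \<Longrightarrow> Forall x (A \<^bold>\<longrightarrow> B) \<^bold>\<longrightarrow> (Exists x A \<^bold>\<longrightarrow> B) \<in> IF_axioms"
| forall_shift_disj:
    "x \<notin> fv B \<Longrightarrow> Forall x (A \<^bold>\<or> B) \<^bold>\<longrightarrow> (Forall x A \<^bold>\<or> B) \<in> IF_axioms"

text \<open>
  Parameters belong to the sequent language only. Excluding them from the axioms excludes them from
  all theorems (lemma \<open>IF_pars\<close>).
\<close>

inductive_set IF :: "'p fm set" where
  axiom: "A \<in> IF_axioms \<Longrightarrow> pars A = {} \<Longrightarrow> A \<in> IF"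
| modus_ponens: "A \<in> IF \<Longrightarrow> A \<^bold>\<longrightarrow> B \<in> IF \<Longrightarrow> B \<in> IF"
| generalization: "A \<in> IF \<Longrightarrow> Forall x A \<in> IF"

lemma IF_pars: "A \<in> IF \<Longrightarrow> pars A = {}"
  by (induction rule: IF.induct) auto


section \<open>Linear nested sequents\<close>

datatype 'p component = Component "'p fm multiset" "'p fm multiset"  (infix \<open>\<turnstile>\<close> 45)

primrec component_fms :: "'p component \<Rightarrow> 'p fm set" where
  "component_fms (\<Gamma> \<turnstile> \<Delta>) = set_mset \<Gamma> \<union> set_mset \<Delta>"

type_synonym 'p lns = "'p component list"

definition lns_fms :: "'p lns \<Rightarrow> 'p fm set" where
  "lns_fms S = (\<Union>c\<in>set S. component_fms c)"

definition lns_pars :: "'p lns \<Rightarrow> par set" where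
  "lns_pars S = (\<Union>A\<in>lns_fms S. pars A)"

definition lns_closed :: "'p lns \<Rightarrow> bool" where
  "lns_closed S \<longleftrightarrow> (\<forall>A\<in>lns_fms S. fv A = {})"

text \<open>
  In a sequent, every free position is occupied by a parameter. This is required of the initial
  sequents, and then holds of every derivable sequent (lemma \<open>LNIF_closed\<close>). The empty list is not a
  linear nested sequent, and is not derivable (lemma \<open>LNIF_nonempty\<close>).
\<close>

inductive LNIF :: "'p lns \<Rightarrow> bool" where
  id1: "lns_closed (G @ [add_mset (Atom p (map Par as)) \<Gamma> \<turnstile> add_mset (Atom p (map Par as)) \<Delta>] @ H) \<Longrightarrow>
    LNIF (G @ [add_mset (Atom p (map Par as)) \<Gamma> \<turnstile> add_mset (Atom p (map Par as)) \<Delta>] @ H)"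
| id2: "lns_closed (G @ [add_mset (Atom p (map Par as)) \<Gamma>1 \<turnstile> \<Delta>1] @ H
      @ [\<Gamma>2 \<turnstile> add_mset (Atom p (map Par as)) \<Delta>2] @ F) \<Longrightarrow>
    LNIF (G @ [add_mset (Atom p (map Par as)) \<Gamma>1 \<turnstile> \<Delta>1] @ H
      @ [\<Gamma>2 \<turnstile> add_mset (Atom p (map Par as)) \<Delta>2] @ F)"
| falsum_l: "lns_closed (G @ [add_mset \<^bold>\<bottom> \<Gamma> \<turnstile> \<Delta>] @ H) \<Longrightarrow>
    LNIF (G @ [add_mset \<^bold>\<bottom> \<Gamma> \<turnstile> \<Delta>] @ H)"
| conj_l: "LNIF (G @ [add_mset A (add_mset B \<Gamma>) \<turnstile> \<Delta>] @ H) \<Longrightarrow>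
    LNIF (G @ [add_mset (A \<^bold>\<and> B) \<Gamma> \<turnstile> \<Delta>] @ H)"
| disj_r: "LNIF (G @ [\<Gamma> \<turnstile> add_mset A (add_mset B \<Delta>)] @ H) \<Longrightarrow>
    LNIF (G @ [\<Gamma> \<turnstile> add_mset (A \<^bold>\<or> B) \<Delta>] @ H)"
| conj_r: "LNIF (G @ [\<Gamma> \<turnstile> add_mset A \<Delta>] @ H) \<Longrightarrow>
    LNIF (G @ [\<Gamma> \<turnstile> add_mset B \<Delta>] @ H) \<Longrightarrow>
    LNIF (G @ [\<Gamma> \<turnstile> add_mset (A \<^bold>\<and> B) \<Delta>] @ H)"
| disj_l: "LNIF (G @ [add_mset A \<Gamma> \<turnstile> \<Delta>] @ H) \<Longrightarrow>
    LNIF (G @ [add_mset B \<Gamma> \<turnstile> \<Delta>] @ H) \<Longrightarrow>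
    LNIF (G @ [add_mset (A \<^bold>\<or> B) \<Gamma> \<turnstile> \<Delta>] @ H)"
| impl_r1: "LNIF (G @ [\<Gamma> \<turnstile> \<Delta>] @ [{#A#} \<turnstile> {#B#}]) \<Longrightarrow>
    LNIF (G @ [\<Gamma> \<turnstile> add_mset (A \<^bold>\<longrightarrow> B) \<Delta>])"
| impl_l: "LNIF (G @ [add_mset B \<Gamma> \<turnstile> \<Delta>] @ H) \<Longrightarrow>
    LNIF (G @ [add_mset (A \<^bold>\<longrightarrow> B) \<Gamma> \<turnstile> add_mset A \<Delta>] @ H) \<Longrightarrow>
    LNIF (G @ [add_mset (A \<^bold>\<longrightarrow> B) \<Gamma> \<turnstile> \<Delta>] @ H)"
| lift: "LNIF (G @ [add_mset A \<Gamma>1 \<turnstile> \<Delta>1] @ [add_mset A \<Gamma>2 \<turnstile> \<Delta>2] @ H) \<Longrightarrow>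
    LNIF (G @ [add_mset A \<Gamma>1 \<turnstile> \<Delta>1] @ [\<Gamma>2 \<turnstile> \<Delta>2] @ H)"
| forall_l: "LNIF (G @ [add_mset (subst x (Par a) A) (add_mset (Forall x A) \<Gamma>) \<turnstile> \<Delta>] @ H) \<Longrightarrow>
    LNIF (G @ [add_mset (Forall x A) \<Gamma> \<turnstile> \<Delta>] @ H)"
| forall_r1: "LNIF (G @ [\<Gamma> \<turnstile> \<Delta>] @ [{#} \<turnstile> {#subst x (Par a) A#}]) \<Longrightarrow>
    a \<notin> lns_pars (G @ [\<Gamma> \<turnstile> add_mset (Forall x A) \<Delta>]) \<Longrightarrow>
    LNIF (G @ [\<Gamma> \<turnstile> add_mset (Forall x A) \<Delta>])"
| exists_l: "LNIF (G @ [add_mset (subst x (Par a) A) \<Gamma> \<turnstile> \<Delta>] @ H) \<Longrightarrow>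
    a \<notin> lns_pars (G @ [add_mset (Exists x A) \<Gamma> \<turnstile> \<Delta>] @ H) \<Longrightarrow>
    LNIF (G @ [add_mset (Exists x A) \<Gamma> \<turnstile> \<Delta>] @ H)"
| exists_r: "LNIF (G @ [\<Gamma> \<turnstile> add_mset (subst x (Par a) A) (add_mset (Exists x A) \<Delta>)] @ H) \<Longrightarrow>
    LNIF (G @ [\<Gamma> \<turnstile> add_mset (Exists x A) \<Delta>] @ H)"
| impl_r2: "LNIF (G @ [\<Gamma>1 \<turnstile> \<Delta>1] @ [{#A#} \<turnstile> {#B#}] @ [\<Gamma>2 \<turnstile> \<Delta>2] @ H) \<Longrightarrow>
    LNIF (G @ [\<Gamma>1 \<turnstile> \<Delta>1] @ [\<Gamma>2 \<turnstile> add_mset (A \<^bold>\<longrightarrow> B) \<Delta>2] @ H) \<Longrightarrow>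
    LNIF (G @ [\<Gamma>1 \<turnstile> add_mset (A \<^bold>\<longrightarrow> B) \<Delta>1] @ [\<Gamma>2 \<turnstile> \<Delta>2] @ H)"
| forall_r2: "LNIF (G @ [\<Gamma>1 \<turnstile> \<Delta>1] @ [{#} \<turnstile> {#subst x (Par a) A#}] @ [\<Gamma>2 \<turnstile> \<Delta>2] @ H) \<Longrightarrow>
    LNIF (G @ [\<Gamma>1 \<turnstile> \<Delta>1] @ [\<Gamma>2 \<turnstile> add_mset (Forall x A) \<Delta>2] @ H) \<Longrightarrow>
    a \<notin> lns_pars (G @ [\<Gamma>1 \<turnstile> add_mset (Forall x A) \<Delta>1] @ [\<Gamma>2 \<turnstile> \<Delta>2] @ H) \<Longrightarrow>
    LNIF (G @ [\<Gamma>1 \<turnstile> add_mset (Forall x A) \<Delta>1] @ [\<Gamma>2 \<turnstile> \<Delta>2] @ H)"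

lemma fv_inst_tm: "fv_tm (inst_tm \<sigma> t) = (\<Union>x\<in>fv_tm t. fv_tm (\<sigma> x))"
  by (cases t) auto

lemma fv_inst_superset: "y \<in> fv A \<Longrightarrow> \<sigma> y = Var y \<Longrightarrow> y \<in> fv (inst \<sigma> A)"
proof (induction A arbitrary: \<sigma>)
  case (Atom p ts)
  then show ?case by (force simp: fv_inst_tm)
qed auto

lemma fv_subst_closed: "fv (subst x (Par a) A) = {} \<Longrightarrow> fv A \<subseteq> {x}"
  by (metis empty_iff fun_upd_other fv_inst_superset insertI1 subsetI)

lemma LNIF_closed: "LNIF S \<Longrightarrow> lns_closed S"
  by (induction rule: LNIF.induct)
    (auto simp: lns_closed_def lns_fms_def dest!: fv_subst_closed)

lemma LNIF_nonempty: "LNIF S \<Longrightarrow> S \<noteq> []"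
  by (induction rule: LNIF.induct) auto

end

theory Submission
  imports Defs "HOL-Library.Countable_Set"
begin

text \<open>
  The proof is semantic. The Hilbert system is sound for linearly ordered Kripke models with constant
  domain. Conversely, an underivable sequent has an underivable premise under every applicable rule,
  and the premise either keeps the principal formula or contains subformulae that settle its truth
  value. A fair backward search from an underivable sequent therefore never closes and, in the limit,
  yields a linearly ordered system of components saturated under the rules; this is a countermodel
  whose worlds are the components and whose domain is the set of parameters. Neither cut nor any
  structural rule is needed.
\<close>

section \<open>Linear Kripke models with constant domain\<close>

text \<open>The shape of the search is dictated by formulae that speak about later worlds. An
  implication or universal formula on the right asks for a later world whose place among the
  existing components is unknown; the rules \<open>impl_r1\<close>, \<open>impl_r2\<close> and their
  \<open>Forall\<close> analogues together try every place, so components must be insertable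
  anywhere to the right. An implication on the left constrains all later worlds, including those
  inserted after it was treated; hence it is copied with \<open>lift\<close>, and its treatment has
  to recur at arbitrarily late stages. Linearity of the order validates the axiom
  \<open>linearity\<close>, and constancy of the domain validates
  \<open>forall_shift_disj\<close>.\<close>

primrec val_tm :: "(var \<Rightarrow> par) \<Rightarrow> tm \<Rightarrow> par" where
  "val_tm \<sigma> (Var x) = \<sigma> x"
| "val_tm \<sigma> (Par a) = a"

locale linear_kripke =
  fixes W :: "'w::linorder set"
    and V :: "'w \<Rightarrow> 'p \<Rightarrow> par list \<Rightarrow> bool"
  assumes V_mono: "v \<in> W \<Longrightarrow> w \<in> W \<Longrightarrow> v \<le> w \<Longrightarrow> V v p ds \<Longrightarrow> V w p ds"
begin

text \<open>Every world has all of \<open>par\<close> as its domain, so the \<open>Forall\<close>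
  clause, unlike that of implication, can stay at the world \<open>w\<close>: no new individuals
  appear later, and \<open>forces_mono\<close> carries each instance upwards.\<close>

primrec forces :: "'w \<Rightarrow> (var \<Rightarrow> par) \<Rightarrow> 'p fm \<Rightarrow> bool" where
  "forces w \<sigma> (Atom p ts) \<longleftrightarrow> V w p (map (val_tm \<sigma>) ts)"
| "forces w \<sigma> \<^bold>\<bottom> \<longleftrightarrow> False"
| "forces w \<sigma> (A \<^bold>\<and> B) \<longleftrightarrow> forces w \<sigma> A \<and> forces w \<sigma> B"
| "forces w \<sigma> (A \<^bold>\<or> B) \<longleftrightarrow> forces w \<sigma> A \<or> forces w \<sigma> B"
| "forces w \<sigma> (A \<^bold>\<longrightarrow> B) \<longleftrightarrow> (\<forall>v\<in>W. w \<le> v \<longrightarrow> forces v \<sigma> A \<longrightarrow> forces v \<sigma> B)"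
| "forces w \<sigma> (Forall x A) \<longleftrightarrow> (\<forall>d. forces w (\<sigma>(x := d)) A)"
| "forces w \<sigma> (Exists x A) \<longleftrightarrow> (\<exists>d. forces w (\<sigma>(x := d)) A)"

lemma forces_mono: "forces v \<sigma> A \<Longrightarrow> v \<in> W \<Longrightarrow> w \<in> W \<Longrightarrow> v \<le> w \<Longrightarrow> forces w \<sigma> A"
  by (induction A arbitrary: \<sigma>) (auto intro: V_mono order_trans)

lemma forces_cong: "(\<And>x. x \<in> fv A \<Longrightarrow> \<sigma> x = \<tau> x) \<Longrightarrow> forces w \<sigma> A \<longleftrightarrow> forces w \<tau> A"
proof (induction A arbitrary: \<sigma> \<tau> w)
  case (Atom p ts)
  have "val_tm \<sigma> t = val_tm \<tau> t" if "t \<in> set ts" for t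
    using that Atom by - (cases t, force+)
  then have "map (val_tm \<sigma>) ts = map (val_tm \<tau>) ts" by simp
  then show ?case by (simp only: forces.simps)
next
  case (Impl A B)
  have "forces v \<sigma> A \<longleftrightarrow> forces v \<tau> A" "forces v \<sigma> B \<longleftrightarrow> forces v \<tau> B" for v
    using Impl.prems by (auto intro!: Impl.IH)
  then show ?case by simp
next
  case (Conj A B)
  have "forces v \<sigma> A \<longleftrightarrow> forces v \<tau> A" "forces v \<sigma> B \<longleftrightarrow> forces v \<tau> B" for v
    using Conj.prems by (auto intro!: Conj.IH)
  then show ?case by simp
next
  case (Disj A B)
  have "forces v \<sigma> A \<longleftrightarrow> forces v \<tau> A" "forces v \<sigma> B \<longleftrightarrow> forces v \<tau> B" for v
    using Disj.prems by (auto intro!: Disj.IH)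
  then show ?case by simp
next
  case (Forall x A)
  have "forces w (\<sigma>(x := d)) A \<longleftrightarrow> forces w (\<tau>(x := d)) A" for d
    using Forall.prems by (intro Forall.IH) auto
  then show ?case by simp
next
  case (Exists x A)
  have "forces w (\<sigma>(x := d)) A \<longleftrightarrow> forces w (\<tau>(x := d)) A" for d
    using Exists.prems by (intro Exists.IH) auto
  then show ?case by simp
qed simp

lemma val_inst_tm: "val_tm \<sigma> (inst_tm \<tau> t) = val_tm (\<lambda>x. val_tm \<sigma> (\<tau> x)) t"
  by (cases t) auto

text \<open>The assumption on \<open>\<tau>\<close> excludes capture: parameters are never bound,
  and a variable sent to itself stays with its binder. Passing under a quantifier therefore commutes
  with evaluation.\<close>

lemma forces_inst:
  assumes "\<And>x. \<tau> x = Var x \<or> (\<exists>a. \<tau> x = Par a)"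
  shows "forces w \<sigma> (inst \<tau> A) \<longleftrightarrow> forces w (\<lambda>x. val_tm \<sigma> (\<tau> x)) A"
  using assms
proof (induction A arbitrary: w \<sigma> \<tau>)
  case (Atom p ts)
  then show ?case by (simp add: val_inst_tm comp_def)
next
  case (Forall x A)
  have "(\<lambda>y. val_tm (\<sigma>(x := d)) ((\<tau>(x := Var x)) y)) = (\<lambda>y. val_tm \<sigma> (\<tau> y))(x := d)" for d
  proof
    fix y
    show "val_tm (\<sigma>(x := d)) ((\<tau>(x := Var x)) y) = ((\<lambda>y. val_tm \<sigma> (\<tau> y))(x := d)) y"
      using Forall.prems[of y] by auto
  qed
  moreover have "forces w (\<sigma>(x := d)) (inst (\<tau>(x := Var x)) A)
      \<longleftrightarrow> forces w (\<lambda>y. val_tm (\<sigma>(x := d)) ((\<tau>(x := Var x)) y)) A" for d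
    using Forall.prems by (intro Forall.IH) auto
  ultimately show ?case by (simp del: fun_upd_apply)
next
  case (Exists x A)
  have "(\<lambda>y. val_tm (\<sigma>(x := d)) ((\<tau>(x := Var x)) y)) = (\<lambda>y. val_tm \<sigma> (\<tau> y))(x := d)" for d
  proof
    fix y
    show "val_tm (\<sigma>(x := d)) ((\<tau>(x := Var x)) y) = ((\<lambda>y. val_tm \<sigma> (\<tau> y))(x := d)) y"
      using Exists.prems[of y] by auto
  qed
  moreover have "forces w (\<sigma>(x := d)) (inst (\<tau>(x := Var x)) A)
      \<longleftrightarrow> forces w (\<lambda>y. val_tm (\<sigma>(x := d)) ((\<tau>(x := Var x)) y)) A" for d
    using Exists.prems by (intro Exists.IH) auto
  ultimately show ?case by (simp del: fun_upd_apply)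
qed (simp_all)

lemma forces_subst_par: "forces w \<sigma> (subst x (Par a) A) \<longleftrightarrow> forces w (\<sigma>(x := a)) A"
proof -
  have "(\<lambda>y. val_tm \<sigma> ((Var(x := Par a)) y)) = \<sigma>(x := a)" by auto
  then show ?thesis by (subst forces_inst) auto
qed

lemma forces_inst_Par: "forces w \<sigma> (inst (\<lambda>x. Par (\<rho> x)) A) \<longleftrightarrow> forces w \<rho> A"
  by (subst forces_inst) auto

lemma inst_id: "(\<And>x. x \<in> fv A \<Longrightarrow> \<tau> x = Var x) \<Longrightarrow> inst \<tau> A = A"
proof (induction A arbitrary: \<tau>)
  case (Atom p ts)
  have "inst_tm \<tau> t = t" if "t \<in> set ts" for t
    using that Atom by - (cases t, force+)
  then show ?case by (simp add: map_idI)
qed auto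

text \<open>A variable can be captured, so \<open>forces_inst\<close> does not apply. Of the two
  alternatives of \<open>free_for\<close> at a quantifier, one makes the substitution the identity
  and the other lets the two updates of \<open>\<sigma>\<close> commute.\<close>

lemma forces_subst_var:
  "free_for y x A \<Longrightarrow> forces w \<sigma> (subst x (Var y) A) \<longleftrightarrow> forces w (\<sigma>(x := \<sigma> y)) A"
proof (induction A arbitrary: w \<sigma>)
  case (Atom p ts)
  have "val_tm \<sigma> (inst_tm (Var(x := Var y)) t) = val_tm (\<sigma>(x := \<sigma> y)) t" for t
    by (cases t) auto
  then show ?case by (simp only: inst.simps forces.simps map_map comp_def)
next
  case (Forall z A)
  show ?case
  proof (cases "x \<in> fv (Forall z A)")
    case True
    then have "z \<noteq> x" "z \<noteq> y" "free_for y x A" using Forall.prems by auto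
    moreover from this have "Var(x := Var y, z := Var z) = Var(x := Var y)"
      "\<sigma>(x := \<sigma> y, z := d) = \<sigma>(z := d, x := (\<sigma>(z := d)) y)" for d
      by auto
    ultimately show ?thesis using Forall.IH by (simp del: fun_upd_apply)
  next
    case False
    then have "subst x (Var y) (Forall z A) = Forall z A" by (intro inst_id) auto
    moreover have "forces w (\<sigma>(x := \<sigma> y)) (Forall z A) \<longleftrightarrow> forces w \<sigma> (Forall z A)"
      using False by (intro forces_cong) auto
    ultimately show ?thesis by (simp only:)
  qed
next
  case (Exists z A)
  show ?case
  proof (cases "x \<in> fv (Exists z A)")
    case True
    then have "z \<noteq> x" "z \<noteq> y" "free_for y x A" using Exists.prems by auto
    moreover from this have "Var(x := Var y, z := Var z) = Var(x := Var y)"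
      "\<sigma>(x := \<sigma> y, z := d) = \<sigma>(z := d, x := (\<sigma>(z := d)) y)" for d
      by auto
    ultimately show ?thesis using Exists.IH by (simp del: fun_upd_apply)
  next
    case False
    then have "subst x (Var y) (Exists z A) = Exists z A" by (intro inst_id) auto
    moreover have "forces w (\<sigma>(x := \<sigma> y)) (Exists z A) \<longleftrightarrow> forces w \<sigma> (Exists z A)"
      using False by (intro forces_cong) auto
    ultimately show ?thesis by (simp only:)
  qed
qed auto

lemma forces_upd_notin: "x \<notin> fv B \<Longrightarrow> forces w (\<sigma>(x := d)) B \<longleftrightarrow> forces w \<sigma> B"
  by (rule forces_cong) auto

lemma forces_axiom: "A \<in> IF_axioms \<Longrightarrow> w \<in> W \<Longrightarrow> forces w \<sigma> A"
proof (induction arbitrary: w \<sigma> rule: IF_axioms.induct)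
  case (K A B)
  then show ?case by (auto intro: forces_mono)
next
  case (S A B C)
  then show ?case by simp
next
  case (conj_I A B)
  then show ?case by (auto intro: forces_mono)
next
  case (disj_E A C B)
  then show ?case by simp
next
  case (linearity A B)
  \<comment> \<open>If \<open>v\<close> refutes the first implication and \<open>u\<close> the
    second, then \<open>A\<close> holds at \<open>v\<close> but not at \<open>u\<close>, and
    \<open>B\<close> at \<open>u\<close> but not at \<open>v\<close>; whichever of the two worlds is
    earlier, persistence is violated.\<close>
  then show ?case by simp (meson forces_mono linear)
next
  case (forall_E y x A)
  then show ?case by (simp add: forces_subst_var)
next
  case (exists_I y x A)
  then show ?case by (auto simp: forces_subst_var)
next
  case (forall_shift_impl x B A)
  then show ?case by (auto simp: forces_upd_notin)
next
  case (exists_shift_impl x B A)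
  then show ?case by (auto simp: forces_upd_notin)
next
  case (forall_shift_disj x B A)
  \<comment> \<open>If \<open>B\<close> fails at a world, every instance of \<open>A\<close> holds
    at that same world, and with a constant domain this is all that \<open>Forall x A\<close>
    says.\<close>
  then show ?case by (auto simp: forces_upd_notin)
qed auto

lemma IF_sound: "A \<in> IF \<Longrightarrow> w \<in> W \<Longrightarrow> forces w \<sigma> A"
  by (induction arbitrary: w \<sigma> rule: IF.induct) (auto simp: forces_axiom)

end


section \<open>Hintikka systems\<close>

lemma size_inst [simp]: "size (inst \<sigma> A) = size A"
  by (induction A arbitrary: \<sigma>) auto

lemma closed_Atom_Par: "fv (Atom p ts) = {} \<Longrightarrow> \<exists>ds. ts = map Par ds"
proof (induction ts)
  case (Cons t ts)
  then show ?case by (cases t) (auto intro: exI[of _ "_ # _"])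
qed simp

text \<open>Only \<open>Impl_L\<close> and \<open>Atom_L\<close> look from a left formula to later
  worlds. In \<open>Impl_L\<close> the conclusion may sit at any \<open>k \<le> j\<close>, since
  forcing persists from \<open>k\<close> to \<open>j\<close>. \<open>Forall_R\<close> mentions
  \<open>W\<close> explicitly because membership in \<open>R\<close> does not yield it, whereas in
  \<open>Impl_R\<close> it follows from \<open>A \<in> L j\<close>.\<close>

locale hintikka =
  fixes W :: "'w::linorder set"
    and L R :: "'w \<Rightarrow> 'p fm set"
  assumes L_W: "F \<in> L i \<Longrightarrow> i \<in> W"
    and closed_R: "F \<in> R i \<Longrightarrow> fv F = {}"
    and closed_L: "F \<in> L i \<Longrightarrow> fv F = {}"
    and Atom_L: "Atom p (map Par ds) \<in> L i \<Longrightarrow> i \<le> j \<Longrightarrow> Atom p (map Par ds) \<notin> R j"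
    and Falsum_L: "\<^bold>\<bottom> \<notin> L i"
    and Conj_L: "A \<^bold>\<and> B \<in> L i \<Longrightarrow> A \<in> L i \<and> B \<in> L i"
    and Conj_R: "A \<^bold>\<and> B \<in> R i \<Longrightarrow> A \<in> R i \<or> B \<in> R i"
    and Disj_L: "A \<^bold>\<or> B \<in> L i \<Longrightarrow> A \<in> L i \<or> B \<in> L i"
    and Disj_R: "A \<^bold>\<or> B \<in> R i \<Longrightarrow> A \<in> R i \<and> B \<in> R i"
    and Impl_L: "A \<^bold>\<longrightarrow> B \<in> L i \<Longrightarrow> j \<in> W \<Longrightarrow> i \<le> j \<Longrightarrow> A \<in> R j \<or> (\<exists>k\<le>j. B \<in> L k)"
    and Impl_R: "A \<^bold>\<longrightarrow> B \<in> R i \<Longrightarrow> \<exists>j\<ge>i. A \<in> L j \<and> B \<in> R j"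
    and Forall_L: "Forall x A \<in> L i \<Longrightarrow> subst x (Par a) A \<in> L i"
    and Forall_R: "Forall x A \<in> R i \<Longrightarrow> \<exists>j\<ge>i. j \<in> W \<and> (\<exists>a. subst x (Par a) A \<in> R j)"
    and Exists_L: "Exists x A \<in> L i \<Longrightarrow> \<exists>a. subst x (Par a) A \<in> L i"
    and Exists_R: "Exists x A \<in> R i \<Longrightarrow> subst x (Par a) A \<in> R i"

text \<open>Collecting the atoms of all earlier worlds makes the valuation monotone by
  construction.\<close>

sublocale hintikka \<subseteq> linear_kripke W "\<lambda>w p ds. \<exists>v\<le>w. Atom p (map Par ds) \<in> L v"
  by unfold_locales (meson order_trans)

context hintikka
begin

text \<open>The induction is on size because an instance \<open>subst x (Par a) A\<close> is no
  subformula of the quantified formula, but has the size of \<open>A\<close>.\<close>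

lemma truth:
  assumes "i \<in> W"
  shows "(F \<in> L i \<longrightarrow> forces i \<sigma> F) \<and> (F \<in> R i \<longrightarrow> \<not> forces i \<sigma> F)"
  using assms
proof (induction "size F" arbitrary: F i \<sigma> rule: less_induct)
  case less
  note i = \<open>i \<in> W\<close>
  have IHL: "forces j \<tau> G" if "size G < size F" "G \<in> L j" for G j \<tau>
    using less.hyps[OF that(1) L_W[OF that(2)], of \<tau>] that(2) by simp
  have IHR: "\<not> forces j \<tau> G" if "size G < size F" "G \<in> R j" "j \<in> W" for G j \<tau>
    using less.hyps[OF that(1,3), of \<tau>] that(2) by simp
  show ?case
  proof (cases F)
    case (Atom p ts)
    have "\<exists>ds. ts = map Par ds" if "F \<in> L i \<or> F \<in> R i"
      using that closed_L[of F i] closed_R[of F i] closed_Atom_Par[of p ts] Atom by auto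
    moreover have "F \<notin> R i" if "ts = map Par ds" "v \<le> i" "Atom p (map Par ds) \<in> L v" for v ds
      using that Atom_L[of p ds v i] Atom by simp
    ultimately show ?thesis by (fastforce simp: Atom comp_def)
  next
    case Falsum
    then show ?thesis using Falsum_L by simp
  next
    case (Conj A B)
    then show ?thesis using Conj_L[of A B i] Conj_R[of A B i] i IHL[of A] IHL[of B] IHR[of A] IHR[of B]
      by auto
  next
    case (Disj A B)
    then show ?thesis using Disj_L[of A B i] Disj_R[of A B i] i IHL[of A] IHL[of B] IHR[of A] IHR[of B]
      by auto
  next
    case (Impl A B)
    have "forces j \<sigma> B" if j: "F \<in> L i" "j \<in> W" "i \<le> j" "forces j \<sigma> A" for j
    proof -
      \<comment> \<open>Since \<open>A\<close> is forced at \<open>j\<close>, the induction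
        hypothesis rules out the first alternative of \<open>Impl_L\<close>.\<close>
      have "A \<notin> R j" using IHR[of A j \<sigma>] j Impl by auto
      then obtain k where "k \<le> j" "B \<in> L k" using Impl_L[of A B i j] j Impl by auto
      moreover have "k \<in> W" using \<open>B \<in> L k\<close> L_W by blast
      ultimately show ?thesis using forces_mono[of k \<sigma> B j] IHL[of B k] j Impl by simp
    qed
    moreover have "\<exists>j\<in>W. i \<le> j \<and> forces j \<sigma> A \<and> \<not> forces j \<sigma> B" if FR: "F \<in> R i"
    proof -
      obtain j where "j \<ge> i" "A \<in> L j" "B \<in> R j" using Impl_R[of A B i] FR Impl by auto
      moreover from this have "j \<in> W" using L_W by blast
      ultimately show ?thesis using IHL[of A j] IHR[of B j] Impl by auto
    qed
    ultimately show ?thesis unfolding Impl by auto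
  next
    case (Forall x A)
    have "forces i (\<sigma>(x := a)) A" if "F \<in> L i" for a
      using IHL[of "subst x (Par a) A" i \<sigma>] Forall_L[of x A i] that Forall by (simp add: forces_subst_par)
    moreover have "\<exists>a. \<not> forces i (\<sigma>(x := a)) A" if FR: "F \<in> R i"
    proof -
      obtain j a where j: "j \<ge> i" "j \<in> W" "subst x (Par a) A \<in> R j" using Forall_R[of x A i] FR Forall by auto
      then have "\<not> forces j (\<sigma>(x := a)) A"
        using IHR[of "subst x (Par a) A" j \<sigma>] Forall by (simp add: forces_subst_par)
      then show ?thesis using forces_mono[OF _ i j(2,1)] by blast
    qed
    ultimately show ?thesis unfolding Forall by auto
  next
    case (Exists x A)
    have "\<exists>a. forces i (\<sigma>(x := a)) A" if FL: "F \<in> L i"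
    proof -
      obtain a where "subst x (Par a) A \<in> L i" using Exists_L[of x A i] FL Exists by auto
      then show ?thesis using IHL[of "subst x (Par a) A" i \<sigma>] Exists
        by (auto simp: forces_subst_par)
    qed
    moreover have "\<not> forces i (\<sigma>(x := a)) A" if "F \<in> R i" for a
      using IHR[of "subst x (Par a) A" i \<sigma>] Exists_R[of x A i] that Exists i by (simp add: forces_subst_par)
    ultimately show ?thesis unfolding Exists by auto
  qed
qed

end


section \<open>Derived rules\<close>

lemma finite_lns_pars: "finite (lns_pars S)"
proof -
  have "finite (pars A)" for A :: "'p fm"
  proof (induction A)
    case (Atom p ts)
    have "finite (pars_tm t)" for t by (cases t) auto
    then show ?case by simp
  qed auto
  moreover have "finite (component_fms c)" for c :: "'p component" by (cases c) auto
  ultimately show ?thesis unfolding lns_pars_def lns_fms_def by blast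
qed

lemma ex_fresh_par: "\<exists>a. a \<notin> lns_pars S"
  using ex_new_if_finite[OF infinite_UNIV_nat finite_lns_pars] by blast

primrec add_left :: "'p fm \<Rightarrow> 'p component \<Rightarrow> 'p component" where
  "add_left A (\<Gamma> \<turnstile> \<Delta>) = (add_mset A \<Gamma> \<turnstile> \<Delta>)"

text \<open>\<open>lift\<close> reaches only the adjacent component, but each copy it makes can
  serve as the source for the next one; the prefix \<open>G\<close> grows along the way.\<close>

lemma lift_all:
  "LNIF (G @ [add_mset A \<Gamma> \<turnstile> \<Delta>] @ map (add_left A) H) \<Longrightarrow> LNIF (G @ [add_mset A \<Gamma> \<turnstile> \<Delta>] @ H)"
proof (induction H arbitrary: G \<Gamma> \<Delta>)
  case (Cons c H)
  obtain \<Gamma>2 \<Delta>2 where c: "c = (\<Gamma>2 \<turnstile> \<Delta>2)" by (cases c)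
  show ?case
    using Cons.IH[of "G @ [add_mset A \<Gamma> \<turnstile> \<Delta>]" \<Gamma>2 \<Delta>2] Cons.prems
      lift[of G A \<Gamma> \<Delta> \<Gamma>2 \<Delta>2 H]
    by (simp add: c)
qed simp

text \<open>Iterating \<open>impl_r2\<close> walks the implication to the right, leaving one premise
  per position of the new component, until \<open>impl_r1\<close> closes the walk at the end. Read
  backwards, an underivable conclusion singles out a position for the refuting world.\<close>

lemma impl_r_split:
  assumes "\<And>H1 H2. H = H1 @ H2 \<Longrightarrow> LNIF (G @ [\<Gamma> \<turnstile> \<Delta>] @ H1 @ [{#A#} \<turnstile> {#B#}] @ H2)"
  shows "LNIF (G @ [\<Gamma> \<turnstile> add_mset (A \<^bold>\<longrightarrow> B) \<Delta>] @ H)"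
  using assms
proof (induction H arbitrary: G \<Gamma> \<Delta>)
  case Nil
  then show ?case using impl_r1[of G \<Gamma> \<Delta> A B] by simp
next
  case (Cons c H)
  obtain \<Gamma>2 \<Delta>2 where c: "c = (\<Gamma>2 \<turnstile> \<Delta>2)" by (cases c)
  have "LNIF ((G @ [\<Gamma> \<turnstile> \<Delta>]) @ [\<Gamma>2 \<turnstile> add_mset (A \<^bold>\<longrightarrow> B) \<Delta>2] @ H)"
    using Cons.prems[of "c # _"] by (intro Cons.IH) (simp add: c)
  then show ?case using impl_r2[of G \<Gamma> \<Delta> A B \<Gamma>2 \<Delta>2 H] Cons.prems[of "[]"] by (simp add: c)
qed

text \<open>The premises are demanded for all parameters because each step of the walk has its own
  conclusion, hence its own eigenvariable. Read backwards, some position and some parameter remain,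
  which is all that saturation asks for.\<close>

lemma forall_r_split:
  assumes "\<And>H1 H2 a. H = H1 @ H2 \<Longrightarrow> LNIF (G @ [\<Gamma> \<turnstile> \<Delta>] @ H1 @ [{#} \<turnstile> {#subst x (Par a) A#}] @ H2)"
  shows "LNIF (G @ [\<Gamma> \<turnstile> add_mset (Forall x A) \<Delta>] @ H)"
  using assms
proof (induction H arbitrary: G \<Gamma> \<Delta>)
  case Nil
  obtain a where "a \<notin> lns_pars (G @ [\<Gamma> \<turnstile> add_mset (Forall x A) \<Delta>])" using ex_fresh_par by blast
  with Nil[of "[]" "[]" a] show ?case using forall_r1[of G \<Gamma> \<Delta> x a A] by (simp del: fun_upd_apply)
next
  case (Cons c H)
  obtain \<Gamma>2 \<Delta>2 where c: "c = (\<Gamma>2 \<turnstile> \<Delta>2)" by (cases c)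
  obtain a where a: "a \<notin> lns_pars (G @ [\<Gamma> \<turnstile> add_mset (Forall x A) \<Delta>] @ [\<Gamma>2 \<turnstile> \<Delta>2] @ H)"
    using ex_fresh_par by blast
  have "LNIF ((G @ [\<Gamma> \<turnstile> \<Delta>]) @ [\<Gamma>2 \<turnstile> add_mset (Forall x A) \<Delta>2] @ H)"
    using Cons.prems[of "c # _"] by (intro Cons.IH) (simp add: c)
  then show ?case using forall_r2[OF _ _ a] Cons.prems[of "[]"] by (simp add: c del: fun_upd_apply)
qed


section \<open>Backward search\<close>

text \<open>The predicate type may be uncountable, so the search is confined to the finitely many predicates
  of the formula to be refuted.\<close>

definition closed_fms :: "'p set \<Rightarrow> 'p fm set" where
  "closed_fms P = {F. fv F = {} \<and> set_fm F \<subseteq> P}"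

lemma set_fm_inst [simp]: "set_fm (inst \<sigma> A) = set_fm A"
  by (induction A arbitrary: \<sigma>) auto

lemma finite_set_fm: "finite (set_fm A)"
  by (induction A) auto

lemma fv_inst_subset:
  "\<forall>x. \<sigma> x = Var x \<or> (\<exists>a. \<sigma> x = Par a) \<Longrightarrow> fv (inst \<sigma> A) \<subseteq> fv A - {x. \<exists>a. \<sigma> x = Par a}"
proof (induction A arbitrary: \<sigma>)
  case (Atom p ts)
  have "fv_tm (inst_tm \<sigma> t) \<subseteq> fv_tm t - {x. \<exists>a. \<sigma> x = Par a}" for t
    using Atom by (cases t) (auto, (metis fv_tm.simps empty_iff singletonD)+)
  then show ?case by auto
next
  case (Forall y A)
  have "fv (inst (\<sigma>(y := Var y)) A) \<subseteq> fv A - {x. \<exists>a. (\<sigma>(y := Var y)) x = Par a}"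
    using Forall.prems by (intro Forall.IH) auto
  then show ?case by (auto split: if_splits)
next
  case (Exists y A)
  have "fv (inst (\<sigma>(y := Var y)) A) \<subseteq> fv A - {x. \<exists>a. (\<sigma>(y := Var y)) x = Par a}"
    using Exists.prems by (intro Exists.IH) auto
  then show ?case by (auto split: if_splits)
qed (simp_all add: Un_Diff le_supI1 le_supI2)

lemma fv_subst_Par: "fv (subst x (Par a) A) = fv A - {x}"
proof
  have "{z. \<exists>b. (Var(x := Par a)) z = Par b} = {x}" by auto
  then show "fv (subst x (Par a) A) \<subseteq> fv A - {x}"
    using fv_inst_subset[of "Var(x := Par a)" A] by (metis fun_upd_apply)
  show "fv A - {x} \<subseteq> fv (subst x (Par a) A)" by (auto intro: fv_inst_superset)
qed

lemma closed_fms_simps [simp]: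
  "A \<^bold>\<and> B \<in> closed_fms P \<longleftrightarrow> A \<in> closed_fms P \<and> B \<in> closed_fms P"
  "A \<^bold>\<or> B \<in> closed_fms P \<longleftrightarrow> A \<in> closed_fms P \<and> B \<in> closed_fms P"
  "A \<^bold>\<longrightarrow> B \<in> closed_fms P \<longleftrightarrow> A \<in> closed_fms P \<and> B \<in> closed_fms P"
  "Forall x A \<in> closed_fms P \<longleftrightarrow> subst x (Par a) A \<in> closed_fms P"
  "Exists x A \<in> closed_fms P \<longleftrightarrow> subst x (Par a) A \<in> closed_fms P"
  by (auto simp: closed_fms_def fv_subst_Par)

instance tm :: countable by countable_datatype
instance fm :: (countable) countable by countable_datatype

text \<open>Numbering the predicates in \<open>P\<close> exhibits these formulae as images of
  formulae over \<open>nat\<close>, a countable type.\<close>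

lemma countable_closed_fms: "finite P \<Longrightarrow> countable (closed_fms P)"
proof -
  assume P: "finite P"
  have "closed_fms P \<subseteq> range (map_fm (from_nat_into P))"
  proof
    fix F assume "F \<in> closed_fms P"
    then have "map_fm (from_nat_into P \<circ> to_nat_on P) F = map_fm id F"
      using P by (intro fm.map_cong0) (auto simp: closed_fms_def countable_finite)
    then show "F \<in> range (map_fm (from_nat_into P))"
      by (metis fm.map_comp fm.map_id rangeI)
  qed
  then show ?thesis by (rule countable_subset) simp
qed

text \<open>Labelling components by rationals leaves room for a new component between any two others,
  and fixes the order of the worlds of the limit in advance.\<close>

datatype 'p state =
  State (labels: "rat list") (lhs: "rat \<Rightarrow> 'p fm multiset") (rhs: "rat \<Rightarrow> 'p fm multiset")

definition sequent :: "'p state \<Rightarrow> 'p lns" where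
  "sequent S = map (\<lambda>i. lhs S i \<turnstile> rhs S i) (labels S)"

text \<open>Emptiness outside the labels means that an occurrence of a formula at \<open>i\<close>
  makes \<open>i\<close> a label, and that occupying a fresh label overwrites nothing.\<close>

definition open_state :: "'p set \<Rightarrow> 'p state \<Rightarrow> bool" where
  "open_state P S \<longleftrightarrow> sorted_wrt (<) (labels S)
    \<and> (\<forall>i. i \<notin> set (labels S) \<longrightarrow> lhs S i = {#} \<and> rhs S i = {#})
    \<and> (\<forall>i. set_mset (lhs S i) \<subseteq> closed_fms P \<and> set_mset (rhs S i) \<subseteq> closed_fms P)
    \<and> \<not> LNIF (sequent S)"

abbreviation upd :: "'p state \<Rightarrow> rat \<Rightarrow> 'p fm multiset \<Rightarrow> 'p fm multiset \<Rightarrow> 'p state" where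
  "upd S i \<Gamma> \<Delta> \<equiv> State (labels S) ((lhs S)(i := \<Gamma>)) ((rhs S)(i := \<Delta>))"

text \<open>\<open>consumed\<close> says what excuses the disappearance of a formula from a component, \<open>treated\<close> what is
  achieved when the search attends to a formula; the two differ on formulae that rules retain.\<close>

fun consumed_left :: "'p state \<Rightarrow> rat \<Rightarrow> 'p fm \<Rightarrow> bool" where
  "consumed_left S i (A \<^bold>\<and> B) \<longleftrightarrow> A \<in># lhs S i \<and> B \<in># lhs S i"
| "consumed_left S i (A \<^bold>\<or> B) \<longleftrightarrow> A \<in># lhs S i \<or> B \<in># lhs S i"
| "consumed_left S i (A \<^bold>\<longrightarrow> B) \<longleftrightarrow> B \<in># lhs S i"
| "consumed_left S i (Exists x A) \<longleftrightarrow> (\<exists>a. subst x (Par a) A \<in># lhs S i)"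
| "consumed_left S i _ \<longleftrightarrow> False"

fun consumed_right :: "'p state \<Rightarrow> rat \<Rightarrow> 'p fm \<Rightarrow> bool" where
  "consumed_right S i (A \<^bold>\<and> B) \<longleftrightarrow> A \<in># rhs S i \<or> B \<in># rhs S i"
| "consumed_right S i (A \<^bold>\<or> B) \<longleftrightarrow> A \<in># rhs S i \<and> B \<in># rhs S i"
| "consumed_right S i (A \<^bold>\<longrightarrow> B) \<longleftrightarrow> (\<exists>j\<ge>i. A \<in># lhs S j \<and> B \<in># rhs S j)"
| "consumed_right S i (Forall x A) \<longleftrightarrow> (\<exists>j\<ge>i. \<exists>a. subst x (Par a) A \<in># rhs S j)"
| "consumed_right S i _ \<longleftrightarrow> False"

fun treated_left :: "'p state \<Rightarrow> rat \<Rightarrow> par \<Rightarrow> 'p fm \<Rightarrow> bool" where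
  "treated_left S i a (A \<^bold>\<longrightarrow> B) \<longleftrightarrow> consumed_left S i (A \<^bold>\<longrightarrow> B) \<or>
    A \<in># rhs S i \<and> (\<forall>j\<in>set (labels S). i \<le> j \<longrightarrow> A \<^bold>\<longrightarrow> B \<in># lhs S j)"
| "treated_left S i a (Forall x A) \<longleftrightarrow> subst x (Par a) A \<in># lhs S i"
| "treated_left S i a (Atom p ts) \<longleftrightarrow> True"
| "treated_left S i a \<^bold>\<bottom> \<longleftrightarrow> True"
| "treated_left S i a F \<longleftrightarrow> consumed_left S i F"

fun treated_right :: "'p state \<Rightarrow> rat \<Rightarrow> par \<Rightarrow> 'p fm \<Rightarrow> bool" where
  "treated_right S i a (Exists x A) \<longleftrightarrow> subst x (Par a) A \<in># rhs S i"
| "treated_right S i a (Atom p ts) \<longleftrightarrow> True"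
| "treated_right S i a \<^bold>\<bottom> \<longleftrightarrow> True"
| "treated_right S i a F \<longleftrightarrow> consumed_right S i F"

text \<open>This relation is for single steps and is not transitive: the formulae that excuse a loss
  may be consumed later themselves. The limit collects everything that ever occurs, so an excuse
  valid at one stage suffices.\<close>

definition extends :: "'p state \<Rightarrow> 'p state \<Rightarrow> bool" where
  "extends S S' \<longleftrightarrow> set (labels S) \<subseteq> set (labels S')
    \<and> (\<forall>i F. F \<in># lhs S i \<longrightarrow> F \<in># lhs S' i \<or> consumed_left S' i F)
    \<and> (\<forall>i F. F \<in># rhs S i \<longrightarrow> F \<in># rhs S' i \<or> consumed_right S' i F)"

lemma extends_refl: "extends S S"
  by (simp add: extends_def)

definition before :: "'p state \<Rightarrow> rat \<Rightarrow> 'p lns" where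
  "before S i = map (\<lambda>j. lhs S j \<turnstile> rhs S j) (filter (\<lambda>j. j < i) (labels S))"

definition after :: "'p state \<Rightarrow> rat \<Rightarrow> 'p lns" where
  "after S i = map (\<lambda>j. lhs S j \<turnstile> rhs S j) (filter (\<lambda>j. i < j) (labels S))"

lemma sorted_split:
  fixes i :: "'a::linorder"
  assumes "sorted_wrt (<) ls" and "i \<in> set ls"
  shows "ls = filter (\<lambda>j. j < i) ls @ i # filter (\<lambda>j. i < j) ls"
proof -
  obtain Gs Hs where ls: "ls = Gs @ i # Hs" using assms(2) split_list by metis
  then have "\<forall>j\<in>set Gs. j < i" "\<forall>j\<in>set Hs. i < j"
    using assms(1) by (auto simp: sorted_wrt_append)
  then have "filter (\<lambda>j. j < i) Gs = Gs" "filter (\<lambda>j. j < i) Hs = []"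
    "filter (\<lambda>j. i < j) Gs = []" "filter (\<lambda>j. i < j) Hs = Hs"
    by (auto simp: filter_id_conv filter_empty_conv)
  then show ?thesis by (simp add: ls)
qed

lemma sequent_split:
  assumes "sorted_wrt (<) (labels S)" and "i \<in> set (labels S)"
  shows "sequent S = before S i @ [lhs S i \<turnstile> rhs S i] @ after S i"
  unfolding sequent_def before_def after_def by (subst sorted_split[OF assms]) simp

lemma open_upd:
  assumes S: "open_state P S" and i: "i \<in> set (labels S)"
    and "set_mset \<Gamma> \<subseteq> closed_fms P" and "set_mset \<Delta> \<subseteq> closed_fms P"
    and nd: "\<not> LNIF (before S i @ [\<Gamma> \<turnstile> \<Delta>] @ after S i)"
  shows "open_state P (upd S i \<Gamma> \<Delta>)"
proof -
  have "before (upd S i \<Gamma> \<Delta>) i = before S i" "after (upd S i \<Gamma> \<Delta>) i = after S i"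
    by (auto simp: before_def after_def)
  then have "sequent (upd S i \<Gamma> \<Delta>) = before S i @ [\<Gamma> \<turnstile> \<Delta>] @ after S i"
    using S i sequent_split[of "upd S i \<Gamma> \<Delta>" i] by (simp add: open_state_def)
  then show ?thesis
    using assms by (auto simp: open_state_def)
qed

lemma open_lift:
  assumes S: "open_state P S" and i: "i \<in> set (labels S)"
    and "set_mset \<Gamma> \<subseteq> closed_fms P" and "set_mset \<Delta> \<subseteq> closed_fms P" and "F \<in> closed_fms P"
    and nd: "\<not> LNIF (before S i @ [\<Gamma> \<turnstile> \<Delta>] @ map (add_left F) (after S i))"
  shows "open_state P (State (labels S)
    (\<lambda>j. if j = i then \<Gamma> else if j \<in> set (labels S) \<and> i < j then add_mset F (lhs S j) else lhs S j)
    ((rhs S)(i := \<Delta>)))" (is "open_state P ?S")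
proof -
  have "before ?S i = before S i" "after ?S i = map (add_left F) (after S i)"
    by (auto simp: before_def after_def)
  then have "sequent ?S = before S i @ [\<Gamma> \<turnstile> \<Delta>] @ map (add_left F) (after S i)"
    using S i sequent_split[of ?S i] by (simp add: open_state_def)
  then show ?thesis
    using assms unfolding open_state_def by (simp add: subset_iff)
qed

text \<open>The gap between \<open>H1\<close> and \<open>H2\<close> becomes a label by density of
  the rationals; if nothing follows the gap, the largest label plus one serves. Sortedness of
  \<open>ls\<close> lets the label alone record the position.\<close>

lemma open_insert:
  assumes S: "open_state P S" and i: "i \<in> set (labels S)"
    and H: "after S i = H1 @ H2"
    and fms: "set_mset \<Gamma> \<subseteq> closed_fms P" "set_mset \<Delta> \<subseteq> closed_fms P"
      "set_mset \<Gamma>' \<subseteq> closed_fms P" "set_mset \<Delta>' \<subseteq> closed_fms P"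
    and nd: "\<not> LNIF (before S i @ [\<Gamma> \<turnstile> \<Delta>] @ H1 @ [\<Gamma>' \<turnstile> \<Delta>'] @ H2)"
  obtains k ls where "i < k" and "k \<notin> set (labels S)" and "set ls = insert k (set (labels S))"
    and "open_state P (State ls ((lhs S)(i := \<Gamma>, k := \<Gamma>')) ((rhs S)(i := \<Delta>, k := \<Delta>')))"
proof -
  let ?c = "\<lambda>j. lhs S j \<turnstile> rhs S j"
  define Gs where "Gs = filter (\<lambda>j. j < i) (labels S)"
  obtain Hs1 Hs2 where Hs: "filter (\<lambda>j. i < j) (labels S) = Hs1 @ Hs2"
    and H12: "H1 = map ?c Hs1" "H2 = map ?c Hs2"
    using H unfolding after_def map_eq_append_conv by blast
  have ls: "labels S = Gs @ i # Hs1 @ Hs2"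
    using sorted_split[OF _ i] S by (simp add: open_state_def Gs_def Hs)
  have sorted: "sorted_wrt (<) ((Gs @ i # Hs1) @ Hs2)"
    using S by (simp add: open_state_def ls)
  obtain k where k: "\<And>j. j \<in> set (Gs @ i # Hs1) \<Longrightarrow> j < k" "\<And>j. j \<in> set Hs2 \<Longrightarrow> k < j"
  proof -
    let ?A = "set (Gs @ i # Hs1)"
    have le: "j \<le> Max ?A" if "j \<in> ?A" for j
      using that by (intro Max_ge) auto
    show thesis
    proof (cases Hs2)
      case Nil
      have "j < Max ?A + 1" if "j \<in> ?A" for j
        using le[OF that] by linarith
      then show ?thesis using Nil by (intro that[of "Max ?A + 1"]) (blast, simp)
    next
      case (Cons h Hs3)
      have "Max ?A < h"
        using sorted Cons by (auto simp: sorted_wrt_append)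
      then obtain k where k: "Max ?A < k" "k < h" using dense by blast
      have "h \<le> j" if "j \<in> set Hs2" for j
        using sorted Cons that by (auto simp: sorted_wrt_append)
      then show ?thesis using that[of k] le k order_le_less_trans order_less_le_trans by blast
    qed
  qed
  let ?ls = "Gs @ i # Hs1 @ k # Hs2"
  let ?S = "State ?ls ((lhs S)(i := \<Gamma>, k := \<Gamma>')) ((rhs S)(i := \<Delta>, k := \<Delta>'))"
  have "i < k" using k(1) by simp
  have kS: "k \<notin> set (labels S)"
    using k by (fastforce simp: ls)
  have "sorted_wrt (<) ?ls"
    using sorted k by (auto simp: sorted_wrt_append)
  moreover have "map (\<lambda>j. lhs ?S j \<turnstile> rhs ?S j) Gs = map ?c Gs"
    "map (\<lambda>j. lhs ?S j \<turnstile> rhs ?S j) Hs1 = map ?c Hs1"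
    "map (\<lambda>j. lhs ?S j \<turnstile> rhs ?S j) Hs2 = map ?c Hs2"
    using kS sorted by (auto simp: ls sorted_wrt_append)
  then have "sequent ?S = before S i @ [\<Gamma> \<turnstile> \<Delta>] @ H1 @ [\<Gamma>' \<turnstile> \<Delta>'] @ H2"
    using \<open>i < k\<close> by (simp add: sequent_def before_def H12 flip: Gs_def)
  ultimately have "open_state P ?S"
    using S fms nd unfolding open_state_def by (auto simp: ls)
  moreover have "set ?ls = insert k (set (labels S))" by (auto simp: ls)
  ultimately show thesis
    using that \<open>i < k\<close> kS by blast
qed

lemma extends_upd:
  assumes "\<And>F. F \<in># lhs S i \<Longrightarrow> F \<in># \<Gamma> \<or> consumed_left (upd S i \<Gamma> \<Delta>) i F"
    and "\<And>F. F \<in># rhs S i \<Longrightarrow> F \<in># \<Delta> \<or> consumed_right (upd S i \<Gamma> \<Delta>) i F"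
  shows "extends S (upd S i \<Gamma> \<Delta>)"
  using assms by (auto simp: extends_def)

section \<open>Single search steps\<close>

text \<open>Each case reads a rule contrapositively: if the conclusion is underivable, so is one of
  the premises, which becomes the next state.\<close>

lemma treat_left:
  assumes S: "open_state P S"
  shows "\<exists>S'. open_state P S' \<and> extends S S' \<and> (F \<in># lhs S i \<longrightarrow> treated_left S' i a F)"
proof (cases "F \<in># lhs S i")
  case False
  then show ?thesis using S extends_refl by blast
next
  case True
  then have i: "i \<in> set (labels S)" using S by (auto simp: open_state_def)
  obtain \<Gamma> where \<Gamma>: "lhs S i = add_mset F \<Gamma>" using True by (metis multi_member_split)
  define \<Delta> where "\<Delta> = rhs S i"
  have "set_mset (lhs S i) \<subseteq> closed_fms P" "set_mset (rhs S i) \<subseteq> closed_fms P"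
    using S unfolding open_state_def by blast+
  then have fms: "F \<in> closed_fms P" "set_mset \<Gamma> \<subseteq> closed_fms P" "set_mset \<Delta> \<subseteq> closed_fms P"
    by (auto simp: \<Gamma> \<Delta>_def)
  let ?G = "before S i" and ?H = "after S i"
  have nd: "\<not> LNIF (?G @ [add_mset F \<Gamma> \<turnstile> \<Delta>] @ ?H)"
    using S i sequent_split[of S i] by (simp add: open_state_def \<Gamma> \<Delta>_def)
  have upd': ?thesis
    if "\<not> LNIF (?G @ [\<Gamma>' \<turnstile> \<Delta>] @ ?H)" "set_mset \<Gamma>' \<subseteq> closed_fms P" "set_mset \<Gamma> \<subseteq> set_mset \<Gamma>'"
      "treated_left (upd S i \<Gamma>' \<Delta>) i a F"
      "F \<in># \<Gamma>' \<or> consumed_left (upd S i \<Gamma>' \<Delta>) i F" for \<Gamma>'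
  proof -
    have "extends S (upd S i \<Gamma>' \<Delta>)"
      using that(3,5) by (intro extends_upd) (auto simp: \<Gamma> \<Delta>_def)
    then show ?thesis using open_upd[OF S i that(2) fms(3) that(1)] that(4) by blast
  qed
  show ?thesis
  proof (cases F)
    case (Atom p ts)
    then show ?thesis using S extends_refl by (intro exI[of _ S]) simp
  next
    case Falsum
    then show ?thesis using S extends_refl by (intro exI[of _ S]) simp
  next
    case (Conj A B)
    then have "\<not> LNIF (?G @ [add_mset A (add_mset B \<Gamma>) \<turnstile> \<Delta>] @ ?H)" using nd conj_l by blast
    then show ?thesis using fms by (intro upd'[of "add_mset A (add_mset B \<Gamma>)"]) (auto simp: Conj)
  next
    case (Disj A B)
    then consider "\<not> LNIF (?G @ [add_mset A \<Gamma> \<turnstile> \<Delta>] @ ?H)" | "\<not> LNIF (?G @ [add_mset B \<Gamma> \<turnstile> \<Delta>] @ ?H)"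
      using nd disj_l by blast
    then show ?thesis
    proof cases
      case 1
      then show ?thesis using fms by (intro upd'[of "add_mset A \<Gamma>"]) (auto simp: Disj)
    next
      case 2
      then show ?thesis using fms by (intro upd'[of "add_mset B \<Gamma>"]) (auto simp: Disj)
    qed
  next
    case (Impl A B)
    then consider "\<not> LNIF (?G @ [add_mset B \<Gamma> \<turnstile> \<Delta>] @ ?H)"
      | "\<not> LNIF (?G @ [add_mset F \<Gamma> \<turnstile> add_mset A \<Delta>] @ ?H)"
      using nd impl_l by blast
    then show ?thesis
    proof cases
      case 1
      then show ?thesis using fms by (intro upd'[of "add_mset B \<Gamma>"]) (auto simp: Impl)
    next
      case 2
      \<comment> \<open>The implication stays at \<open>i\<close>, and \<open>lift_all\<close> also
        places it at every later label, where it must eventually be decided as well.\<close>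
      let ?S = "State (labels S)
        (\<lambda>j. if j = i then add_mset F \<Gamma> else if j \<in> set (labels S) \<and> i < j
          then add_mset F (lhs S j) else lhs S j)
        ((rhs S)(i := add_mset A \<Delta>))"
      have "open_state P ?S"
        using 2 lift_all[of ?G F \<Gamma> "add_mset A \<Delta>" ?H] fms Impl by (intro open_lift[OF S i]) auto
      moreover have "extends S ?S"
        by (auto simp: extends_def \<Gamma> \<Delta>_def)
      moreover have "treated_left ?S i a F" by (simp add: Impl)
      ultimately show ?thesis by blast
    qed
  next
    case (Forall x A)
    then have "\<not> LNIF (?G @ [add_mset (subst x (Par a) A) (add_mset F \<Gamma>) \<turnstile> \<Delta>] @ ?H)"
      using nd forall_l by blast
    then show ?thesis using fms
      by (intro upd'[of "add_mset (subst x (Par a) A) (add_mset F \<Gamma>)"])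
        (auto simp: Forall closed_fms_simps(4)[of x A P a])
  next
    case (Exists x A)
    \<comment> \<open>The eigenvariable condition of \<open>exists_l\<close> dictates a fresh
      witness, in place of the scheduled parameter \<open>a\<close>.\<close>
    obtain b where "b \<notin> lns_pars (?G @ [add_mset F \<Gamma> \<turnstile> \<Delta>] @ ?H)" using ex_fresh_par by blast
    then have "\<not> LNIF (?G @ [add_mset (subst x (Par b) A) \<Gamma> \<turnstile> \<Delta>] @ ?H)"
      using nd exists_l unfolding Exists by blast
    then show ?thesis using fms
      by (intro upd'[of "add_mset (subst x (Par b) A) \<Gamma>"])
        (auto simp: Exists closed_fms_simps(5)[of x A P b])
  qed
qed

lemma treat_right:
  assumes S: "open_state P S"
  shows "\<exists>S'. open_state P S' \<and> extends S S' \<and> (F \<in># rhs S i \<longrightarrow> treated_right S' i a F)"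
proof (cases "F \<in># rhs S i")
  case False
  then show ?thesis using S extends_refl by blast
next
  case True
  then have i: "i \<in> set (labels S)" using S by (auto simp: open_state_def)
  obtain \<Delta> where \<Delta>: "rhs S i = add_mset F \<Delta>" using True by (metis multi_member_split)
  define \<Gamma> where "\<Gamma> = lhs S i"
  have "set_mset (lhs S i) \<subseteq> closed_fms P" "set_mset (rhs S i) \<subseteq> closed_fms P"
    using S unfolding open_state_def by blast+
  then have fms: "F \<in> closed_fms P" "set_mset \<Gamma> \<subseteq> closed_fms P" "set_mset \<Delta> \<subseteq> closed_fms P"
    by (auto simp: \<Delta> \<Gamma>_def)
  let ?G = "before S i" and ?H = "after S i"
  have nd: "\<not> LNIF (?G @ [\<Gamma> \<turnstile> add_mset F \<Delta>] @ ?H)"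
    using S i sequent_split[of S i] by (simp add: open_state_def \<Delta> \<Gamma>_def)
  have upd': ?thesis
    if "\<not> LNIF (?G @ [\<Gamma> \<turnstile> \<Delta>'] @ ?H)" "set_mset \<Delta>' \<subseteq> closed_fms P" "set_mset \<Delta> \<subseteq> set_mset \<Delta>'"
      "treated_right (upd S i \<Gamma> \<Delta>') i a F"
      "F \<in># \<Delta>' \<or> consumed_right (upd S i \<Gamma> \<Delta>') i F" for \<Delta>'
  proof -
    have "extends S (upd S i \<Gamma> \<Delta>')"
      using that(3,5) by (intro extends_upd) (auto simp: \<Delta> \<Gamma>_def)
    then show ?thesis using open_upd[OF S i fms(2) that(2) that(1)] that(4) by blast
  qed
  \<comment> \<open>The last condition is stated for an arbitrary state and label, since the
    rational supplied by \<open>open_insert\<close> is not known in advance.\<close>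
  have insert': ?thesis
    if h: "?H = H1 @ H2" "\<not> LNIF (?G @ [\<Gamma> \<turnstile> \<Delta>] @ H1 @ [\<Gamma>' \<turnstile> \<Delta>'] @ H2)"
      "set_mset \<Gamma>' \<subseteq> closed_fms P" "set_mset \<Delta>' \<subseteq> closed_fms P"
      "\<And>S' k. i \<le> k \<Longrightarrow> \<forall>F\<in>#\<Gamma>'. F \<in># lhs S' k \<Longrightarrow> \<forall>F\<in>#\<Delta>'. F \<in># rhs S' k \<Longrightarrow>
        consumed_right S' i F \<and> treated_right S' i a F" for H1 H2 \<Gamma>' \<Delta>'
  proof -
    obtain k ls where k: "i < k" "k \<notin> set (labels S)" "set ls = insert k (set (labels S))"
      and S': "open_state P (State ls ((lhs S)(i := \<Gamma>, k := \<Gamma>')) ((rhs S)(i := \<Delta>, k := \<Delta>')))"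
      (is "open_state P ?S'")
      using open_insert[OF S i h(1) fms(2,3) h(3,4,2)] by blast
    have t: "consumed_right ?S' i F \<and> treated_right ?S' i a F"
      using k by (intro h(5)[of k]) auto
    have "lhs S k = {#}" "rhs S k = {#}" using S k(2) by (auto simp: open_state_def)
    then have "extends S ?S'"
      using t k by (auto simp: extends_def \<Delta> \<Gamma>_def)
    then show ?thesis using S' t by blast
  qed
  show ?thesis
  proof (cases F)
    case (Atom p ts)
    then show ?thesis using S extends_refl by (intro exI[of _ S]) simp
  next
    case Falsum
    then show ?thesis using S extends_refl by (intro exI[of _ S]) simp
  next
    case (Disj A B)
    then have "\<not> LNIF (?G @ [\<Gamma> \<turnstile> add_mset A (add_mset B \<Delta>)] @ ?H)" using nd disj_r by blast
    then show ?thesis using fms by (intro upd'[of "add_mset A (add_mset B \<Delta>)"]) (auto simp: Disj)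
  next
    case (Conj A B)
    then consider "\<not> LNIF (?G @ [\<Gamma> \<turnstile> add_mset A \<Delta>] @ ?H)" | "\<not> LNIF (?G @ [\<Gamma> \<turnstile> add_mset B \<Delta>] @ ?H)"
      using nd conj_r by blast
    then show ?thesis
    proof cases
      case 1
      then show ?thesis using fms by (intro upd'[of "add_mset A \<Delta>"]) (auto simp: Conj)
    next
      case 2
      then show ?thesis using fms by (intro upd'[of "add_mset B \<Delta>"]) (auto simp: Conj)
    qed
  next
    case (Impl A B)
    obtain H1 H2 where H: "?H = H1 @ H2" "\<not> LNIF (?G @ [\<Gamma> \<turnstile> \<Delta>] @ H1 @ [{#A#} \<turnstile> {#B#}] @ H2)"
      using nd impl_r_split[of ?H ?G \<Gamma> \<Delta> A B] unfolding Impl by blast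
    show ?thesis using fms by (intro insert'[OF H]) (auto simp: Impl)
  next
    case (Forall x A)
    obtain H1 H2 b where H: "?H = H1 @ H2"
      "\<not> LNIF (?G @ [\<Gamma> \<turnstile> \<Delta>] @ H1 @ [{#} \<turnstile> {#subst x (Par b) A#}] @ H2)"
      using nd forall_r_split[of ?H ?G \<Gamma> \<Delta> x A] unfolding Forall by blast
    show ?thesis using fms
      by (intro insert'[OF H]) (auto simp: Forall closed_fms_simps(4)[of x A P b])
  next
    case (Exists x A)
    then have "\<not> LNIF (?G @ [\<Gamma> \<turnstile> add_mset (subst x (Par a) A) (add_mset F \<Delta>)] @ ?H)"
      using nd exists_r by blast
    then show ?thesis using fms
      by (intro upd'[of "add_mset (subst x (Par a) A) (add_mset F \<Delta>)"])
        (auto simp: Exists closed_fms_simps(5)[of x A P a])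
  qed
qed

section \<open>Fair scheduling\<close>

text \<open>Position \<open>prod_encode (k, m)\<close> holds the element with index
  \<open>k\<close>, whatever \<open>m\<close> is; it is at least \<open>m\<close>, so every element
  recurs beyond any bound.\<close>

lemma fair_enumeration:
  assumes "countable T"
  obtains e :: "nat \<Rightarrow> 'a" where "\<And>t m. t \<in> T \<Longrightarrow> \<exists>n\<ge>m. e n = t"
proof
  fix t :: 'a and m assume "t \<in> T"
  then obtain k where "from_nat_into T k = t" using assms from_nat_into_surj by metis
  moreover have "m \<le> prod_encode (k, m)" by (rule le_prod_encode_2)
  ultimately show "\<exists>n\<ge>m. (from_nat_into T \<circ> fst \<circ> prod_decode) n = t"
    by (intro exI[of _ "prod_encode (k, m)"]) simp
qed

text \<open>A task names a side, a formula, a label and a parameter. All rationals and parameters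
  are scheduled from the start; a task whose formula is absent is satisfied vacuously and comes up
  again later.\<close>

lemma fair_search:
  assumes "finite P" and "open_state P S0"
  obtains S where "S 0 = S0" and "\<And>n. open_state P (S n)" and "\<And>n. extends (S n) (S (Suc n))"
    and "\<And>F i a m. F \<in> closed_fms P \<Longrightarrow>
      \<exists>n\<ge>m. F \<in># lhs (S n) i \<longrightarrow> treated_left (S (Suc n)) i a F"
    and "\<And>F i a m. F \<in> closed_fms P \<Longrightarrow>
      \<exists>n\<ge>m. F \<in># rhs (S n) i \<longrightarrow> treated_right (S (Suc n)) i a F"
proof -
  let ?T = "(UNIV :: bool set) \<times> closed_fms P \<times> (UNIV :: rat set) \<times> (UNIV :: par set)"
  have "countable ?T" using assms(1) by (intro countable_SIGMA countable_closed_fms) auto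
  then obtain e :: "nat \<Rightarrow> bool \<times> 'a fm \<times> rat \<times> par"
    where e: "\<And>t m. t \<in> ?T \<Longrightarrow> \<exists>n\<ge>m. e n = t"
    using fair_enumeration by blast
  define Q where "Q n S S' \<longleftrightarrow> extends S S' \<and> (case e n of (b, F, i, a) \<Rightarrow>
      if b then F \<in># lhs S i \<longrightarrow> treated_left S' i a F
      else F \<in># rhs S i \<longrightarrow> treated_right S' i a F)" for n S S'
  have "\<exists>S. \<forall>n. (open_state P (S n) \<and> (n = 0 \<longrightarrow> S n = S0)) \<and> Q n (S n) (S (Suc n))"
  proof (rule dependent_nat_choice)
    show "\<exists>S. open_state P S \<and> (0 = 0 \<longrightarrow> S = S0)" using assms(2) by simp
  next
    fix S and n :: nat
    assume "open_state P S \<and> (n = 0 \<longrightarrow> S = S0)"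
    then have S: "open_state P S" by simp
    obtain b F i a where en: "e n = (b, F, i, a)" by (metis prod.exhaust)
    show "\<exists>S'. (open_state P S' \<and> (Suc n = 0 \<longrightarrow> S' = S0)) \<and> Q n S S'"
      using treat_left[OF S, of F i a] treat_right[OF S, of F i a]
      by (cases b) (simp_all add: Q_def en)
  qed
  then obtain S where S: "\<And>n. open_state P (S n)" "S 0 = S0" "\<And>n. Q n (S n) (S (Suc n))"
    by metis
  show thesis
  proof (rule that[of S])
    fix F :: "'a fm" and i a m assume F: "F \<in> closed_fms P"
    obtain n where "n \<ge> m" "e n = (True, F, i, a)" using e[of "(True, F, i, a)" m] F by auto
    then show "\<exists>n\<ge>m. F \<in># lhs (S n) i \<longrightarrow> treated_left (S (Suc n)) i a F"
      using S(3)[of n] by (auto simp: Q_def)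
    obtain n where "n \<ge> m" "e n = (False, F, i, a)" using e[of "(False, F, i, a)" m] F by auto
    then show "\<exists>n\<ge>m. F \<in># rhs (S n) i \<longrightarrow> treated_right (S (Suc n)) i a F"
      using S(3)[of n] by (auto simp: Q_def)
  next
    show "extends (S n) (S (Suc n))" for n using S(3)[of n] by (simp add: Q_def)
  qed (use S in auto)
qed

section \<open>Saturation of the limit\<close>

lemma open_lns_closed: "open_state P S \<Longrightarrow> lns_closed (sequent S)"
  unfolding open_state_def lns_closed_def lns_fms_def sequent_def closed_fms_def by fastforce

text \<open>\<open>id1\<close> excludes \<open>i = j\<close> and \<open>id2\<close> excludes
  \<open>i < j\<close>: exactly the pairs where persistence would force an atom at a world meant to
  refute it.\<close>

lemma open_not_initial:
  assumes S: "open_state P S" and L: "Atom p (map Par ds) \<in># lhs S i"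
    and R: "Atom p (map Par ds) \<in># rhs S j" and ij: "i \<le> j"
  shows False
proof -
  have i: "i \<in> set (labels S)" and j: "j \<in> set (labels S)"
    using S L R by (auto simp: open_state_def)
  have nd: "\<not> LNIF (sequent S)" using S by (simp add: open_state_def)
  have split: "sequent S = before S i @ [lhs S i \<turnstile> rhs S i] @ after S i"
    using S i by (intro sequent_split) (auto simp: open_state_def)
  obtain \<Gamma> \<Delta> where \<Gamma>: "lhs S i = add_mset (Atom p (map Par ds)) \<Gamma>"
    and \<Delta>: "rhs S j = add_mset (Atom p (map Par ds)) \<Delta>"
    using L R by (metis multi_member_split)
  show False
  proof (cases "i = j")
    case True
    then show False using id1[of "before S i" p ds \<Gamma> \<Delta> "after S i"] open_lns_closed[OF S] nd unfolding split \<Gamma> using \<Delta> by auto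
  next
    case False
    then have "(lhs S j \<turnstile> rhs S j) \<in> set (after S i)" using ij j by (auto simp: after_def)
    then obtain H1 H2 where "after S i = H1 @ [lhs S j \<turnstile> rhs S j] @ H2"
      by (metis append_Cons append_Nil split_list)
    then show False
      using id2[of "before S i" p ds \<Gamma> "rhs S i" H1 "lhs S j" \<Delta> H2] open_lns_closed[OF S] nd
      unfolding split \<Gamma> using \<Delta> by auto
  qed
qed

lemma open_Falsum: "open_state P S \<Longrightarrow> \<^bold>\<bottom> \<notin># lhs S i"
proof
  assume S: "open_state P S" and L: "\<^bold>\<bottom> \<in># lhs S i"
  have i: "i \<in> set (labels S)" using S L by (auto simp: open_state_def)
  have nd: "\<not> LNIF (sequent S)" using S by (simp add: open_state_def)
  have split: "sequent S = before S i @ [lhs S i \<turnstile> rhs S i] @ after S i"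
    using S i by (intro sequent_split) (auto simp: open_state_def)
  obtain \<Gamma> where "lhs S i = add_mset \<^bold>\<bottom> \<Gamma>" using L by (metis multi_member_split)
  then show False using falsum_l[of "before S i" \<Gamma> "rhs S i" "after S i"] open_lns_closed[OF S] nd unfolding split by auto
qed

lemma limit_hintikka:
  assumes S: "\<And>n. open_state P (S n)" and ext: "\<And>n. extends (S n) (S (Suc n))"
    and fairL: "\<And>F i a m. F \<in> closed_fms P \<Longrightarrow>
      \<exists>n\<ge>m. F \<in># lhs (S n) i \<longrightarrow> treated_left (S (Suc n)) i a F"
    and fairR: "\<And>F i a m. F \<in> closed_fms P \<Longrightarrow>
      \<exists>n\<ge>m. F \<in># rhs (S n) i \<longrightarrow> treated_right (S (Suc n)) i a F"
  shows "hintikka (\<Union>n. set (labels (S n)))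
    (\<lambda>i. \<Union>n. set_mset (lhs (S n) i)) (\<lambda>i. \<Union>n. set_mset (rhs (S n) i))"
proof -
  define W where "W = (\<Union>n. set (labels (S n)))"
  define L where "L i = (\<Union>n. set_mset (lhs (S n) i))" for i
  define R where "R i = (\<Union>n. set_mset (rhs (S n) i))" for i
  have LI: "F \<in># lhs (S n) i \<Longrightarrow> F \<in> L i" and RI: "F \<in># rhs (S n) i \<Longrightarrow> F \<in> R i" for F n i
    by (auto simp: L_def R_def)
  have LW: "i \<in> W" if F: "F \<in> L i" for F i
  proof -
    obtain n where "F \<in># lhs (S n) i" using F by (auto simp: L_def)
    then have "i \<in> set (labels (S n))" using S[of n] by (auto simp: open_state_def)
    then show ?thesis by (auto simp: W_def)
  qed
  have RW: "i \<in> W" if F: "F \<in> R i" for F i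
  proof -
    obtain n where "F \<in># rhs (S n) i" using F by (auto simp: R_def)
    then have "i \<in> set (labels (S n))" using S[of n] by (auto simp: open_state_def)
    then show ?thesis by (auto simp: W_def)
  qed
  have "set_mset (lhs (S n) i) \<subseteq> closed_fms P \<and> set_mset (rhs (S n) i) \<subseteq> closed_fms P" for n i
    using S[of n] by (simp add: open_state_def)
  then have Lfm: "F \<in> L i \<Longrightarrow> F \<in> closed_fms P" and Rfm: "F \<in> R i \<Longrightarrow> F \<in> closed_fms P" for F i
    by (auto simp: L_def R_def)
  have labels_mono: "set (labels (S m)) \<subseteq> set (labels (S n))" if "m \<le> n" for m n
    using that
  proof (induction rule: dec_induct)
    case (step n)
    have "set (labels (S n)) \<subseteq> set (labels (S (Suc n)))" using ext[of n] by (simp add: extends_def)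
    with step.IH show ?case by (rule subset_trans)
  qed simp
  have persistL: "F \<in># lhs (S n) i \<or> (\<exists>k. consumed_left (S k) i F)"
    if "F \<in># lhs (S m) i" "m \<le> n" for F i m n
    using that(2,1)
  proof (induction rule: dec_induct)
    case (step n)
    have "F \<in># lhs (S n) i \<longrightarrow> F \<in># lhs (S (Suc n)) i \<or> consumed_left (S (Suc n)) i F"
      using ext[of n] by (simp add: extends_def)
    then show ?case using step.IH[OF step.prems] by blast
  qed simp
  have persistR: "F \<in># rhs (S n) i \<or> (\<exists>k. consumed_right (S k) i F)"
    if "F \<in># rhs (S m) i" "m \<le> n" for F i m n
    using that(2,1)
  proof (induction rule: dec_induct)
    case (step n)
    have "F \<in># rhs (S n) i \<longrightarrow> F \<in># rhs (S (Suc n)) i \<or> consumed_right (S (Suc n)) i F"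
      using ext[of n] by (simp add: extends_def)
    then show ?case using step.IH[OF step.prems] by blast
  qed simp
  \<comment> \<open>The bound \<open>N\<close> makes it possible to wait until a given label has
    been created before an implication is treated.\<close>
  have treatL: "(\<exists>k. consumed_left (S k) i F) \<or> (\<exists>n\<ge>N. treated_left (S n) i a F)"
    if F: "F \<in> L i" for F i N a
  proof -
    obtain m where m: "F \<in># lhs (S m) i" using F by (auto simp: L_def)
    obtain n where n: "n \<ge> max m N" "F \<in># lhs (S n) i \<longrightarrow> treated_left (S (Suc n)) i a F"
      using fairL Lfm[OF F] by blast
    then show ?thesis using persistL[OF m, of n] by (metis le_SucI max.bounded_iff)
  qed
  have treatR: "(\<exists>k. consumed_right (S k) i F) \<or> (\<exists>n. treated_right (S n) i a F)"
    if F: "F \<in> R i" for F i a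
  proof -
    obtain m where m: "F \<in># rhs (S m) i" using F by (auto simp: R_def)
    obtain n where n: "n \<ge> m" "F \<in># rhs (S n) i \<longrightarrow> treated_right (S (Suc n)) i a F"
      using fairR Rfm[OF F] by blast
    then show ?thesis using persistR[OF m, of n] by blast
  qed
  have "hintikka W L R"
  proof
    fix p ds i j
    assume "Atom p (map Par ds) \<in> L i" and ij: "i \<le> j"
    then obtain m where m: "Atom p (map Par ds) \<in># lhs (S m) i" by (auto simp: L_def)
    show "Atom p (map Par ds) \<notin> R j"
    proof
      assume "Atom p (map Par ds) \<in> R j"
      then obtain n where n: "Atom p (map Par ds) \<in># rhs (S n) j" by (auto simp: R_def)
      \<comment> \<open>Atoms are never consumed, so both occurrences survive into a common
        stage.\<close>
      have "Atom p (map Par ds) \<in># lhs (S (max m n)) i" "Atom p (map Par ds) \<in># rhs (S (max m n)) j"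
        using persistL[OF m, of "max m n"] persistR[OF n, of "max m n"] by auto
      then show False using open_not_initial[OF S _ _ ij] by blast
    qed
  next
    show "\<^bold>\<bottom> \<notin> L i" for i using open_Falsum[OF S] by (auto simp: L_def)
  next
    show "A \<in> L i \<and> B \<in> L i" if "A \<^bold>\<and> B \<in> L i" for A B i
      using treatL[OF that, of 0] by (auto intro: LI)
  next
    show "A \<in> R i \<or> B \<in> R i" if "A \<^bold>\<and> B \<in> R i" for A B i
      using treatR[OF that] by (auto intro: RI)
  next
    show "A \<in> L i \<or> B \<in> L i" if "A \<^bold>\<or> B \<in> L i" for A B i
      using treatL[OF that, of 0] by (auto intro: LI)
  next
    show "A \<in> R i \<and> B \<in> R i" if "A \<^bold>\<or> B \<in> R i" for A B i
      using treatR[OF that] by (auto intro: RI)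
  next
    fix A B i j
    assume F: "A \<^bold>\<longrightarrow> B \<in> L i" (is "?F \<in> _") and "j \<in> W" and ij: "i \<le> j"
    \<comment> \<open>From stage \<open>N\<close> on, \<open>j\<close> is a label. Unless
      \<open>B\<close> ever enters \<open>L i\<close>, the implication at \<open>i\<close> is never
      consumed, and a treatment after \<open>N\<close> copies it to \<open>j\<close>.\<close>
    then obtain N where N: "j \<in> set (labels (S N))" by (auto simp: W_def)
    show "A \<in> R j \<or> (\<exists>k\<le>j. B \<in> L k)"
    proof (cases "B \<in> L i")
      case True
      then show ?thesis using ij by blast
    next
      case False
      then have nc: "\<not> consumed_left (S k) i ?F" for k using LI by auto
      then obtain n where "n \<ge> N" "treated_left (S n) i 0 ?F"
        using treatL[OF F, of N 0] by blast
      then have "?F \<in># lhs (S n) j" using nc[of n] labels_mono[of N n] N ij by auto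
      then have "?F \<in> L j" by (rule LI)
      \<comment> \<open>Treating the copy at \<open>j\<close> itself puts \<open>B\<close> into
        \<open>L j\<close> or \<open>A\<close> into \<open>R j\<close>.\<close>
      from treatL[OF this, of 0] show ?thesis by (auto intro: LI RI)
    qed
  next
    show "\<exists>j\<ge>i. A \<in> L j \<and> B \<in> R j" if "A \<^bold>\<longrightarrow> B \<in> R i" for A B i
      using treatR[OF that] LI RI by fastforce
  next
    show "subst x (Par a) A \<in> L i" if "Forall x A \<in> L i" for x A i a
      using treatL[OF that, of 0 a] LI by auto
  next
    show "\<exists>j\<ge>i. j \<in> W \<and> (\<exists>a. subst x (Par a) A \<in> R j)" if F: "Forall x A \<in> R i" for x A i
    proof -
      obtain n j a where "j \<ge> i" "subst x (Par a) A \<in># rhs (S n) j"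
        using treatR[OF F] by auto
      then show ?thesis using RI RW by blast
    qed
  next
    show "\<exists>a. subst x (Par a) A \<in> L i" if "Exists x A \<in> L i" for x A i
      using treatL[OF that, of 0] LI by auto
  next
    show "subst x (Par a) A \<in> R i" if "Exists x A \<in> R i" for x A i a
      using treatR[OF that, of a] RI by auto
  qed (use LW Lfm Rfm in \<open>auto simp: closed_fms_def\<close>)
  then show ?thesis unfolding W_def L_def R_def .
qed

theorem theorem3:
  fixes A :: "'p fm" and \<rho> :: "var \<Rightarrow> par"
  assumes "A \<in> IF"
    and "inj_on \<rho> (fv A)"
  shows "LNIF [{#} \<turnstile> {#inst (\<lambda>x. Par (\<rho> x)) A#}]"
proof (rule ccontr)
  let ?A = "inst (\<lambda>x. Par (\<rho> x)) A"
  assume "\<not> ?thesis"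
  moreover have "fv ?A = {}"
    using fv_inst_subset[of "\<lambda>x. Par (\<rho> x)" A] by simp
  moreover define S0 :: "'p state" where "S0 = State [0] (\<lambda>_. {#}) ((\<lambda>_. {#})(0 := {#?A#}))"
  ultimately have "open_state (set_fm A) S0"
    by (auto simp: open_state_def sequent_def closed_fms_def)
  then obtain S where S: "S 0 = S0" "\<And>n. open_state (set_fm A) (S n)" "\<And>n. extends (S n) (S (Suc n))"
    "\<And>F i a m. F \<in> closed_fms (set_fm A) \<Longrightarrow>
      \<exists>n\<ge>m. F \<in># lhs (S n) i \<longrightarrow> treated_left (S (Suc n)) i a F"
    "\<And>F i a m. F \<in> closed_fms (set_fm A) \<Longrightarrow>
      \<exists>n\<ge>m. F \<in># rhs (S n) i \<longrightarrow> treated_right (S (Suc n)) i a F"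
    using fair_search[OF finite_set_fm] by blast
  interpret hintikka "\<Union>n. set (labels (S n))" "\<lambda>i. \<Union>n. set_mset (lhs (S n) i)"
    "\<lambda>i. \<Union>n. set_mset (rhs (S n) i)"
    by (rule limit_hintikka[OF S(2-5)])
  have "0 \<in> set (labels (S 0))" "?A \<in># rhs (S 0) 0"
    by (simp_all add: S(1) S0_def)
  then have 0: "0 \<in> (\<Union>n. set (labels (S n)))" "?A \<in> (\<Union>n. set_mset (rhs (S n) 0))" by blast+
  \<comment> \<open>Evaluating under \<open>\<rho>\<close> is the same as substituting the
    parameters, so the world \<open>0\<close>, the label of the initial component, refutes
    \<open>A\<close> itself, against soundness.\<close>
  then have "\<not> forces 0 \<rho> ?A" using truth by blast
  then have "\<not> forces 0 \<rho> A" using forces_inst_Par by blast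
  then show False using IF_sound[OF assms(1) 0(1)] by blast
qed

end
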